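(* Let $m\ge2$ and let $L(j,\gamma)$, $j\in\{1,\ldots,m\}$, $\gamma\in\mathcal A$, be a real-valued loss with (nonempty) action space $\mathcal A$. Then $L$ induces the same generalized entropy as the zero-one loss, i.e. $H_L(\eta)=1-\max_{k}\eta_k$ for all $\eta\in\Delta_m$, if and only if $$\mathcal S^{\mathrm{zo}}\subset\mathcal S_L\subset\mathcal S^{\mathrm{zo}*},$$ where $\mathcal S_L$ is the value manifold of $L$, $\mathcal S^{\mathrm{zo}}=\{(z_1,\ldots,z_m)^{T}:\sum_{j=1}^mz_j=m-1,\ 0\le z_1,\ldots,z_m\le1\}$, and $\mathcal S^{\mathrm{zo}*}=\{z+b: z\in\mathcal S^{\mathrm{zo}},\ b\in\mathbb R_+^m\}$.
   Context: $\mathbb R_+=[0,\infty)$, $\Delta_m=\{q\in\mathbb R_+^m:\sum_jq_j=1\}$. The generalized entropy of $L$ is $H_L(\eta)=\inf_{\gamma\in\mathcal A}\sum_{j=1}^m\eta_jL(j,\gamma)$. The value manifold of $L$ is the closure of the convex hull, $\mathcal S_L=\overline{\mathrm{conv}}(\mathcal R_L)$, of $\mathcal R_L=\{(L(1,\gamma),\ldots,L(m,\gamma))^{T}:\gamma\in\mathcal A\}\subset\mathbb R^m$. No structure on $\mathcal A$ is assumed. *)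

theory Defs
  imports "HOL-Analysis.Analysis"
begin

(* The class labels 1, ..., m are the elements of a finite type 'm, so m = CARD('m). *)

definition prob_simplex :: "(real ^ 'm) set" where
  "prob_simplex = {q. (\<forall>j. 0 \<le> q $ j) \<and> (\<Sum>j\<in>UNIV. q $ j) = 1}"

(* The infimum is taken in the extended reals: the losses are not assumed to be
   bounded below, so it may be -\<infinity>. *)
definition gen_entropy :: "('m::finite \<Rightarrow> 'a \<Rightarrow> real) \<Rightarrow> 'a set \<Rightarrow> real ^ 'm \<Rightarrow> ereal" where
  "gen_entropy L A \<eta> = (INF \<gamma>\<in>A. ereal (\<Sum>j\<in>UNIV. \<eta> $ j * L j \<gamma>))"

definition loss_range :: "('m::finite \<Rightarrow> 'a \<Rightarrow> real) \<Rightarrow> 'a set \<Rightarrow> (real ^ 'm) set" where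
  "loss_range L A = {(\<chi> j. L j \<gamma>) | \<gamma>. \<gamma> \<in> A}"

definition value_manifold :: "('m::finite \<Rightarrow> 'a \<Rightarrow> real) \<Rightarrow> 'a set \<Rightarrow> (real ^ 'm) set" where
  "value_manifold L A = closure (convex hull loss_range L A)"

definition S_zo :: "(real ^ 'm) set" where
  "S_zo = {z. (\<Sum>j\<in>UNIV. z $ j) = real CARD('m) - 1 \<and> (\<forall>j. 0 \<le> z $ j \<and> z $ j \<le> 1)}"

definition S_zo_star :: "(real ^ 'm) set" where
  "S_zo_star = {z + b | z b. z \<in> S_zo \<and> (\<forall>j. 0 \<le> b $ j)}"

definition zero_one_loss :: "'m \<Rightarrow> 'm \<Rightarrow> real" where
  "zero_one_loss j k = (if j = k then 0 else 1)"

lemma gen_entropy_zero_one_loss: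
  fixes \<eta> :: "real ^ 'm"
  assumes "\<eta> \<in> prob_simplex"
  shows "gen_entropy zero_one_loss UNIV \<eta> = ereal (1 - Max (range (\<lambda>k. \<eta> $ k)))"
proof -
  have risk: "(\<Sum>j\<in>UNIV. \<eta> $ j * zero_one_loss j k) = 1 - \<eta> $ k" for k
  proof -
    have "(\<Sum>j\<in>UNIV. \<eta> $ j * zero_one_loss j k)
        = (\<Sum>j\<in>UNIV. \<eta> $ j - (if j = k then \<eta> $ j else 0))"
      by (intro sum.cong) (auto simp: zero_one_loss_def)
    then show ?thesis
      using assms by (simp add: sum_subtractf prob_simplex_def)
  qed
  have "Max (range (\<lambda>k. \<eta> $ k)) \<in> range (\<lambda>k. \<eta> $ k)"
    by (intro Max_in) auto
  then obtain k0 where k0: "Max (range (\<lambda>k. \<eta> $ k)) = \<eta> $ k0"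
    by blast
  have le: "\<eta> $ k \<le> \<eta> $ k0" for k
    unfolding k0[symmetric] by (intro Max_ge) auto
  have "(INF k. ereal (1 - \<eta> $ k)) = ereal (1 - \<eta> $ k0)"
    by (intro antisym INF_lower INF_greatest) (auto simp: le)
  then show ?thesis
    by (simp add: gen_entropy_def risk k0)
qed

end

theory Submission
  imports Defs
begin

text \<open>The set \<open>S_zo_star\<close> is the intersection of the half-spaces
  \<open>\<eta> \<bullet> z \<ge> 1 - max \<eta>\<close> over the simplex, so it contains the value manifold exactly when the
  zero-one entropy is a lower bound for the entropy of \<open>L\<close>. The set \<open>S_zo\<close> is the convex hull of
  the vertices \<open>1 - e\<^sub>k\<close>. If they lie in the value manifold, the lower bound is attained. Conversely,
  for the weights \<open>\<eta>\<close> proportional to \<open>1 + e\<^sub>k\<close>, the vertex \<open>1 - e\<^sub>k\<close> is the only minimizer of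
  \<open>\<eta> \<bullet> z\<close> over \<open>S_zo_star\<close>, and near-minimizers are close to it; so equality of the entropies forces
  the range of \<open>L\<close> to accumulate at every vertex.\<close>

section \<open>Half-space description of \<open>S_zo_star\<close>\<close>

lemma S_zo_star_risk_ge:
  fixes z \<eta> :: "real ^ 'm::finite"
  assumes z: "z \<in> S_zo_star" and \<eta>: "\<eta> \<in> prob_simplex"
  shows "1 - Max (range (\<lambda>k. \<eta> $ k)) \<le> \<eta> \<bullet> z"
proof -
  obtain s b where s: "s \<in> S_zo" and b: "\<forall>j. 0 \<le> b $ j" and zsb: "z = s + b"
    using z by (auto simp: S_zo_star_def)
  let ?M = "Max (range (\<lambda>k. \<eta> $ k))"
  have le_M: "\<eta> $ k \<le> ?M" for k
    by (intro Max_ge) auto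
  \<comment> \<open>The deficits \<open>1 - s $ j\<close> are nonnegative and sum to 1, so averaging
    the entries of \<open>\<eta>\<close> with them gives at most the largest entry.\<close>
  have "(\<Sum>j\<in>UNIV. \<eta> $ j * (1 - s $ j)) \<le> (\<Sum>j\<in>UNIV. ?M * (1 - s $ j))"
    using s by (intro sum_mono mult_right_mono le_M) (auto simp: S_zo_def)
  also have "\<dots> = ?M"
    using s by (simp add: sum_distrib_left[symmetric] sum_subtractf S_zo_def)
  finally have "1 - ?M \<le> \<eta> \<bullet> s"
    using \<eta> by (simp add: inner_vec_def right_diff_distrib sum_subtractf prob_simplex_def)
  moreover have "0 \<le> \<eta> \<bullet> b"
    using \<eta> b by (auto simp: inner_vec_def prob_simplex_def intro!: sum_nonneg)
  ultimately show ?thesis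
    by (simp add: zsb inner_add_right)
qed

text \<open>Only the coordinates below 1 contribute. The bound comes from testing against the
  uniform distribution on these coordinates \<open>J\<close>, whose maximum is
  \<open>1 / card J\<close>, and clearing the denominator.\<close>

lemma deficit_le_1_if_risk_ge:
  fixes z :: "real ^ 'm::finite"
  assumes risk: "\<And>\<eta>. \<eta> \<in> prob_simplex \<Longrightarrow> 1 - Max (range (\<lambda>k. \<eta> $ k)) \<le> \<eta> \<bullet> z"
  shows "(\<Sum>j\<in>UNIV. max (1 - z $ j) 0) \<le> 1"
proof -
  define J where "J = {j. z $ j < 1}"
  have deficit: "(\<Sum>j\<in>UNIV. max (1 - z $ j) 0) = (\<Sum>j\<in>J. 1 - z $ j)"
    by (rule sum.mono_neutral_cong_right) (auto simp: J_def)
  show ?thesis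
  proof (cases "J = {}")
    case True
    then show ?thesis
      by (simp add: deficit)
  next
    case False
    then have card: "0 < real (card J)"
      by (simp add: card_gt_0_iff)
    define \<eta> :: "real ^ 'm" where "\<eta> = (\<chi> j. if j \<in> J then 1 / real (card J) else 0)"
    have "\<eta> \<in> prob_simplex"
      using card by (auto simp: prob_simplex_def \<eta>_def sum.If_cases)
    moreover have "Max (range (\<lambda>k. \<eta> $ k)) \<le> 1 / real (card J)"
      by (auto simp: \<eta>_def)
    moreover have "\<eta> \<bullet> z = (\<Sum>j\<in>J. z $ j) / real (card J)"
    proof -
      have "\<eta> \<bullet> z = (\<Sum>j\<in>J. z $ j / real (card J))"
        unfolding inner_vec_def by (rule sum.mono_neutral_cong_right) (auto simp: \<eta>_def)
      then show ?thesis
        by (simp add: sum_divide_distrib)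
    qed
    ultimately have "1 - 1 / real (card J) \<le> (\<Sum>j\<in>J. z $ j) / real (card J)"
      using risk[of \<eta>] by linarith
    then have "real (card J) - 1 \<le> (\<Sum>j\<in>J. z $ j)"
      using False card by (simp add: field_simps divide_le_cancel)
    then show ?thesis
      by (simp add: deficit sum_subtractf)
  qed
qed

text \<open>Spreading the slack \<open>1 - sum u UNIV\<close> evenly turns the deficits
  \<open>u\<close> into a probability vector \<open>t\<close> with \<open>u j \<le> t j\<close>.
  Then \<open>1 - t\<close> is a point of \<open>S_zo\<close> that lies below \<open>z\<close> in
  every coordinate.\<close>

lemma S_zo_star_if_deficit_le_1:
  fixes z :: "real ^ 'm::finite"
  assumes "(\<Sum>j\<in>UNIV. max (1 - z $ j) 0) \<le> 1"
  shows "z \<in> S_zo_star"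
proof -
  define u where "u j = max (1 - z $ j) 0" for j
  define t where "t j = u j + (1 - sum u UNIV) / real CARD('m)" for j
  have u_le_t: "u j \<le> t j" for j
    using assms by (simp add: t_def u_def)
  have t_nonneg: "0 \<le> t j" for j
    using u_le_t[of j] by (simp add: u_def)
  have sum_t: "sum t UNIV = 1"
    by (simp add: t_def sum.distrib)
  have t_le_1: "t j \<le> 1" for j
    using member_le_sum[of j UNIV t] t_nonneg sum_t by simp
  let ?s = "(\<chi> j. 1 - t j) :: real ^ 'm"
  have "?s \<in> S_zo"
    using t_nonneg t_le_1 sum_t by (simp add: S_zo_def sum_subtractf)
  moreover have "\<forall>j. 0 \<le> (z - ?s) $ j"
  proof
    fix j
    show "0 \<le> (z - ?s) $ j"
      using u_le_t[of j] by (simp add: u_def)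
  qed
  moreover have "z = ?s + (z - ?s)"
    by simp
  ultimately show ?thesis
    unfolding S_zo_star_def by blast
qed

lemma S_zo_star_eq_risk_ge:
  "S_zo_star = {z :: real ^ 'm::finite.
     \<forall>\<eta>\<in>prob_simplex. 1 - Max (range (\<lambda>k. \<eta> $ k)) \<le> \<eta> \<bullet> z}"
  using S_zo_star_risk_ge S_zo_star_if_deficit_le_1[OF deficit_le_1_if_risk_ge] by blast

text \<open>In this form closedness and convexity are inherited from the half-spaces.\<close>

lemma S_zo_star_eq_Inter_halfspaces:
  "S_zo_star = (\<Inter>\<eta> \<in> prob_simplex.
     {z :: real ^ 'm::finite. \<eta> \<bullet> z \<ge> 1 - Max (range (\<lambda>k. \<eta> $ k))})"
  unfolding S_zo_star_eq_risk_ge by blast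

lemma closed_S_zo_star: "closed (S_zo_star :: (real ^ 'm::finite) set)"
  unfolding S_zo_star_eq_Inter_halfspaces by (intro closed_INT ballI closed_halfspace_ge)

lemma convex_S_zo_star: "convex (S_zo_star :: (real ^ 'm::finite) set)"
  unfolding S_zo_star_eq_Inter_halfspaces by (intro convex_INT convex_halfspace_ge)

section \<open>Entropy as an infimum over the value manifold\<close>

lemma value_manifold_subset:
  assumes "loss_range L A \<subseteq> C" "closed C" "convex C"
  shows "value_manifold L A \<subseteq> C"
  unfolding value_manifold_def using assms by (intro closure_minimal hull_minimal)

lemma loss_range_subset_value_manifold: "loss_range L A \<subseteq> value_manifold L A"
  unfolding value_manifold_def using hull_subset closure_subset by (rule order_trans)

lemma convex_value_manifold: "convex (value_manifold L A)"
  unfolding value_manifold_def by (intro convex_closure convex_convex_hull)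

lemma gen_entropy_eq_INF_inner:
  "gen_entropy L A \<eta> = (INF z\<in>loss_range L A. ereal (\<eta> \<bullet> z))"
proof -
  have "loss_range L A = (\<lambda>\<gamma>. \<chi> j. L j \<gamma>) ` A"
    by (auto simp: loss_range_def)
  then show ?thesis
    by (simp add: gen_entropy_def inner_vec_def image_image)
qed

text \<open>A closed half-space that contains the range also contains its closed convex hull, so
  passing to the hull does not lower the infimum of a linear functional.\<close>

lemma gen_entropy_le_value_manifold:
  assumes "z \<in> value_manifold L A"
  shows "gen_entropy L A \<eta> \<le> ereal (\<eta> \<bullet> z)"
proof (rule ccontr)
  assume "\<not> ?thesis"
  \<comment> \<open>The entropy is an extended real, while a half-space needs a real bound; a real
    \<open>c\<close> strictly in between provides it.\<close>
  then obtain c where c: "\<eta> \<bullet> z < c" "ereal c < gen_entropy L A \<eta>"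
    using ereal_dense2[of "ereal (\<eta> \<bullet> z)" "gen_entropy L A \<eta>"] by (auto simp: not_le)
  have "c \<le> \<eta> \<bullet> y" if "y \<in> loss_range L A" for y
  proof -
    have "gen_entropy L A \<eta> \<le> ereal (\<eta> \<bullet> y)"
      unfolding gen_entropy_eq_INF_inner using that by (rule INF_lower)
    with c(2) show ?thesis
      by (metis ereal_less_eq(3) less_imp_le order_trans)
  qed
  then have "value_manifold L A \<subseteq> {y. \<eta> \<bullet> y \<ge> c}"
    by (intro value_manifold_subset closed_halfspace_ge convex_halfspace_ge) auto
  with assms c(1) show False
    by auto
qed

section \<open>Vertices of \<open>S_zo\<close> and near-minimizers\<close>

lemma zo_vertex_in_S_zo: "1 - axis k 1 \<in> (S_zo :: (real ^ 'm::finite) set)"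
  by (simp add: S_zo_def axis_def sum_subtractf)

text \<open>The deficits \<open>1 - z $ k\<close> of a point of \<open>S_zo\<close> are its weights
  as a convex combination of the vertices.\<close>

lemma S_zo_subset_if_vertices:
  fixes C :: "(real ^ 'm::finite) set"
  assumes "convex C" and vertices: "\<And>k. 1 - axis k 1 \<in> C"
  shows "S_zo \<subseteq> C"
proof
  fix z :: "real ^ 'm"
  assume z: "z \<in> S_zo"
  then have sum1: "(\<Sum>k\<in>UNIV. 1 - z $ k) = 1"
    by (simp add: S_zo_def sum_subtractf)
  have "(\<Sum>k\<in>UNIV. (1 - z $ k) *\<^sub>R (1 - axis k 1 :: real ^ 'm)) \<in> C"
    using z sum1 by (intro convex_sum assms) (auto simp: S_zo_def)
  also have "(\<Sum>k\<in>UNIV. (1 - z $ k) *\<^sub>R (1 - axis k 1 :: real ^ 'm)) = z"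
  proof (rule vec_eq_iff[THEN iffD2], rule allI)
    fix j
    have "(\<Sum>k\<in>UNIV. (1 - z $ k) * axis k 1 $ j) = (\<Sum>k\<in>UNIV. if k = j then 1 - z $ k else 0)"
      by (rule sum.cong) (auto simp: axis_def)
    then have "(\<Sum>k\<in>UNIV. (1 - z $ k) * axis k 1 $ j) = 1 - z $ j"
      by simp
    then show "(\<Sum>k\<in>UNIV. (1 - z $ k) *\<^sub>R (1 - axis k 1 :: real ^ 'm)) $ j = z $ j"
      using sum1 by (simp add: right_diff_distrib sum_subtractf)
  qed
  finally show "z \<in> C" .
qed

lemma S_zo_star_near_vertex:
  fixes z :: "real ^ 'm::finite"
  assumes z: "z \<in> S_zo_star"
    and near: "(1 + axis k 1) \<bullet> z \<le> real CARD('m) - 1 + \<delta>"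
  shows "\<bar>z $ j - (1 - axis k 1 :: real ^ 'm) $ j\<bar> \<le> \<delta>"
proof -
  obtain s b where s: "s \<in> S_zo" and b: "\<And>j. 0 \<le> b $ j" and zsb: "z = s + b"
    using z by (auto simp: S_zo_star_def)
  have sum_s: "(\<Sum>i\<in>UNIV. s $ i) = real CARD('m) - 1" and s01: "\<And>i. 0 \<le> s $ i" "\<And>i. s $ i \<le> 1"
    using s by (auto simp: S_zo_def)
  have "1 \<bullet> z = (\<Sum>i\<in>UNIV. s $ i) + (\<Sum>i\<in>UNIV. b $ i)"
    by (simp add: inner_vec_def zsb sum.distrib)
  \<comment> \<open>The left side is exactly the excess of \<open>(1 + axis k 1) \<bullet> z\<close>
    over \<open>m - 1\<close>. All its terms are nonnegative, so each is at most
    \<open>\<delta>\<close>.\<close>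
  then have small: "s $ k + b $ k + (\<Sum>i\<in>UNIV. b $ i) \<le> \<delta>"
    using near by (simp add: inner_add_left inner_axis' sum_s zsb)
  have bj: "b $ j \<le> (\<Sum>i\<in>UNIV. b $ i)"
    by (rule member_le_sum) (auto simp: b)
  show ?thesis
  proof (cases "j = k")
    case True
    then show ?thesis
      using small bj b[of k] s01[of k] by (simp add: zsb axis_def)
  next
    case False
    \<comment> \<open>All deficits together sum to 1, so a small \<open>s $ k\<close> leaves class
      \<open>j\<close> almost no deficit.\<close>
    have "(\<Sum>i\<in>{j, k}. 1 - s $ i) \<le> (\<Sum>i\<in>UNIV. 1 - s $ i)"
      using s01 by (intro sum_mono2) auto
    then have "1 - s $ j \<le> s $ k"
      using False by (simp add: sum_subtractf sum_s)
    then show ?thesis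
      using False small bj b[of j] b[of k] s01[of j] s01[of k]
      by (simp add: zsb axis_def abs_le_iff)
  qed
qed

lemma zo_vertex_in_closure_if_entropy:
  fixes L :: "'m::finite \<Rightarrow> 'a \<Rightarrow> real"
  assumes entropy: "\<forall>\<eta>\<in>prob_simplex. gen_entropy L A \<eta> = ereal (1 - Max (range (\<lambda>k. \<eta> $ k)))"
    and range: "loss_range L A \<subseteq> S_zo_star"
  shows "1 - axis k 1 \<in> closure (loss_range L A)"
proof (rule closure_approachable[THEN iffD2], intro allI impI)
  fix e :: real
  assume e: "0 < e"
  define m where "m = real CARD('m)"
  have m: "0 < m"
    by (simp add: m_def)
  \<comment> \<open>With an error of at most \<open>\<delta>\<close> in each of \<open>m\<close>
    coordinates, the total error is at most \<open>e / 2\<close>.\<close>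
  define \<delta> where "\<delta> = e / (2 * m)"
  have \<delta>: "0 < \<delta>"
    using e m by (simp add: \<delta>_def)
  define \<eta> :: "real ^ 'm" where "\<eta> = (1 / (m + 1)) *\<^sub>R (1 + axis k 1)"
  have \<eta>_nth: "\<eta> $ j = (if j = k then 2 else 1) / (m + 1)" for j
    by (simp add: \<eta>_def axis_def)
  have "\<eta> \<in> prob_simplex"
  proof -
    have "(\<Sum>j\<in>UNIV. (1 + axis k 1 :: real ^ 'm) $ j) = m + 1"
      by (simp add: sum.distrib axis_def m_def)
    then have "(\<Sum>j\<in>UNIV. \<eta> $ j) = 1"
      using m by (simp add: \<eta>_def flip: sum_divide_distrib)
    then show ?thesis
      using m by (simp add: prob_simplex_def \<eta>_nth)
  qed
  moreover have "Max (range (\<lambda>j. \<eta> $ j)) = 2 / (m + 1)"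
    using m by (intro Max_eqI) (auto simp: \<eta>_nth divide_right_mono intro!: image_eqI[where x = k])
  \<comment> \<open>The infimum may not be attained, so an excess is allowed; scaling by
    \<open>m + 1\<close> turns it into \<open>\<delta>\<close>.\<close>
  ultimately have "gen_entropy L A \<eta> < ereal (1 - 2 / (m + 1) + \<delta> / (m + 1))"
    using entropy m \<delta> by simp
  then obtain z where z: "z \<in> loss_range L A" "\<eta> \<bullet> z < 1 - 2 / (m + 1) + \<delta> / (m + 1)"
    unfolding gen_entropy_eq_INF_inner by (auto simp: INF_less_iff)
  have "\<eta> \<bullet> z = ((1 + axis k 1) \<bullet> z) / (m + 1)"
    by (simp add: \<eta>_def)
  moreover have "1 - 2 / (m + 1) + \<delta> / (m + 1) = (m - 1 + \<delta>) / (m + 1)"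
    using m by (simp add: divide_simps)
  ultimately have "(1 + axis k 1) \<bullet> z \<le> real CARD('m) - 1 + \<delta>"
    using z(2) m by (simp add: divide_less_cancel flip: m_def)
  then have near: "\<bar>z $ j - (1 - axis k 1 :: real ^ 'm) $ j\<bar> \<le> \<delta>" for j
    using z(1) range by (intro S_zo_star_near_vertex) auto
  have "dist z (1 - axis k 1) \<le> (\<Sum>j\<in>UNIV. \<bar>(z - (1 - axis k 1)) $ j\<bar>)"
    unfolding dist_norm by (rule norm_le_l1_cart)
  also have "\<dots> \<le> (\<Sum>j\<in>(UNIV :: 'm set). \<delta>)"
    using near by (intro sum_mono) simp
  also have "\<dots> = e / 2"
    using m by (simp add: \<delta>_def flip: m_def)
  also have "\<dots> < e"
    using e by simp
  finally show "\<exists>y\<in>loss_range L A. dist y (1 - axis k 1) < e"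
    using z(1) by blast
qed

theorem proposition8:
  fixes L :: "'m::finite \<Rightarrow> 'a \<Rightarrow> real" and A :: "'a set"
  assumes "2 \<le> CARD('m)" and "A \<noteq> {}"
  shows "(\<forall>\<eta>\<in>prob_simplex. gen_entropy L A \<eta> = ereal (1 - Max (range (\<lambda>k. \<eta> $ k))))
    \<longleftrightarrow> S_zo \<subseteq> value_manifold L A \<and> value_manifold L A \<subseteq> S_zo_star"
proof
  assume entropy: "\<forall>\<eta>\<in>prob_simplex. gen_entropy L A \<eta> = ereal (1 - Max (range (\<lambda>k. \<eta> $ k)))"
  \<comment> \<open>The risk of a loss vector is never below the entropy, so the half-space
    description applies.\<close>
  have range: "loss_range L A \<subseteq> S_zo_star"
  proof
    fix z
    assume "z \<in> loss_range L A"
    then have le: "gen_entropy L A \<eta> \<le> ereal (\<eta> \<bullet> z)" for \<eta>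
      using loss_range_subset_value_manifold by (intro gen_entropy_le_value_manifold) blast
    have "1 - Max (range (\<lambda>k. \<eta> $ k)) \<le> \<eta> \<bullet> z" if "\<eta> \<in> prob_simplex" for \<eta>
      using le[of \<eta>] unfolding entropy[rule_format, OF that] ereal_less_eq(3) .
    then show "z \<in> S_zo_star"
      unfolding S_zo_star_eq_risk_ge by blast
  qed
  have "1 - axis k 1 \<in> value_manifold L A" for k
    using zo_vertex_in_closure_if_entropy[OF entropy range] closure_mono[OF hull_subset]
    unfolding value_manifold_def by blast
  then have "S_zo \<subseteq> value_manifold L A"
    by (intro S_zo_subset_if_vertices convex_value_manifold)
  moreover have "value_manifold L A \<subseteq> S_zo_star"
    using range closed_S_zo_star convex_S_zo_star by (rule value_manifold_subset)
  ultimately show "S_zo \<subseteq> value_manifold L A \<and> value_manifold L A \<subseteq> S_zo_star" ..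
next
  assume sub: "S_zo \<subseteq> value_manifold L A \<and> value_manifold L A \<subseteq> S_zo_star"
  show "\<forall>\<eta>\<in>prob_simplex. gen_entropy L A \<eta> = ereal (1 - Max (range (\<lambda>k. \<eta> $ k)))"
  proof (intro ballI antisym)
    fix \<eta> :: "real ^ 'm"
    assume \<eta>: "\<eta> \<in> prob_simplex"
    \<comment> \<open>The vertex of a most probable class \<open>k\<close> has risk
      \<open>1 - \<eta> $ k\<close>, which is the bound sought.\<close>
    have "Max (range (\<lambda>k. \<eta> $ k)) \<in> range (\<lambda>k. \<eta> $ k)"
      by (intro Max_in) auto
    then obtain k where k: "Max (range (\<lambda>k. \<eta> $ k)) = \<eta> $ k"
      by blast
    have "\<eta> \<bullet> 1 = 1"
      using \<eta> by (simp add: inner_vec_def prob_simplex_def)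
    then have "\<eta> \<bullet> (1 - axis k 1) = 1 - Max (range (\<lambda>k. \<eta> $ k))"
      by (simp add: inner_diff_right inner_axis k)
    moreover have "1 - axis k 1 \<in> value_manifold L A"
      using sub zo_vertex_in_S_zo by blast
    ultimately show "gen_entropy L A \<eta> \<le> ereal (1 - Max (range (\<lambda>k. \<eta> $ k)))"
      using gen_entropy_le_value_manifold[of "1 - axis k 1" L A \<eta>] by simp
    show "ereal (1 - Max (range (\<lambda>k. \<eta> $ k))) \<le> gen_entropy L A \<eta>"
      unfolding gen_entropy_eq_INF_inner
    proof (rule INF_greatest)
      fix z
      assume "z \<in> loss_range L A"
      then have "z \<in> S_zo_star"
        using sub loss_range_subset_value_manifold by blast
      then show "ereal (1 - Max (range (\<lambda>k. \<eta> $ k))) \<le> ereal (\<eta> \<bullet> z)"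
        using \<eta> unfolding ereal_less_eq(3) by (rule S_zo_star_risk_ge)
    qed
  qed
qed

end
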